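(* Let $n\ge2$, $b\in\{1,\dots,n\}$, $0<\epsilon<1$, and for real $m>0$ let $$C_m(b)=2\left(\frac nm+2b\right)\max\left\{\frac{\mathcal L(b)+2\rho(b)}\mu,\ m\right\}\log\left(\frac1\epsilon\right).$$ Then, for fixed $b$, the loop size $m$ that minimizes $C_m(b)$ over $m>0$ and the resulting total complexity are $$m^*(b)=\frac{\mathcal L(b)+2\rho(b)}\mu\qquad\text{and}\qquad C_{m^*}(b)=2\left(n+2b\,\frac{\mathcal L(b)+2\rho(b)}\mu\right)\log\left(\frac1\epsilon\right).$$
   Context: $L,L_{\max},\mu>0$ are constants: $f=\frac1n\sum_{i=1}^nf_i$ is $L$-smooth and $\mu$-strongly convex on $\mathbb R^d$, each $f_i$ is convex and $L_i$-smooth, and $L_{\max}=\max_iL_i$. Further $\mathcal L(b)=\frac1b\frac{n-b}{n-1}L_{\max}+\frac nb\frac{b-1}{n-1}L$ and $\rho(b)=\frac1b\frac{n-b}{n-1}L_{\max}$. $C_m(b)$ is the total complexity (number of individual gradient evaluations) of the Free-SVRG algorithm with inner-loop length $m$ and mini-batches of size $b$ sampled without replacement. *)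

theory Defs
  imports "HOL-Analysis.Analysis"
begin

(* Differentiable with an L-Lipschitz gradient; lipschitz_on includes 0 <= L. *)
definition L_smooth :: "real \<Rightarrow> ('a::real_inner \<Rightarrow> real) \<Rightarrow> bool" where
  "L_smooth L f \<longleftrightarrow> (\<exists>g. (\<forall>x. GDERIV f x :> g x) \<and> lipschitz_on L UNIV g)"

definition strongly_convex :: "real \<Rightarrow> ('a::real_inner \<Rightarrow> real) \<Rightarrow> bool" where
  "strongly_convex \<mu> f \<longleftrightarrow>
     (\<forall>x y. \<forall>t\<in>{0..1}. f (t *\<^sub>R x + (1 - t) *\<^sub>R y)
        \<le> t * f x + (1 - t) * f y - \<mu> / 2 * t * (1 - t) * (norm (x - y))\<^sup>2)"

definition expected_smoothness :: "nat \<Rightarrow> real \<Rightarrow> real \<Rightarrow> nat \<Rightarrow> real" where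
  "expected_smoothness n Lmax L b =
     1 / real b * ((real n - real b) / (real n - 1)) * Lmax
     + real n / real b * ((real b - 1) / (real n - 1)) * L"

definition expected_residual :: "nat \<Rightarrow> real \<Rightarrow> nat \<Rightarrow> real" where
  "expected_residual n Lmax b = 1 / real b * ((real n - real b) / (real n - 1)) * Lmax"

(* Number of individual gradient evaluations of Free-SVRG: n/m + 2b per inner iteration
   (a full gradient every m iterations, and 2b mini-batch gradients in each), times the
   number of inner iterations needed for accuracy epsilon. The loop size m is a positive real. *)
definition total_complexity ::
  "nat \<Rightarrow> real \<Rightarrow> real \<Rightarrow> real \<Rightarrow> real \<Rightarrow> nat \<Rightarrow> real \<Rightarrow> real" where
  "total_complexity n Lmax L \<mu> \<epsilon> b m =
     2 * (real n / m + 2 * real b)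
     * max ((expected_smoothness n Lmax L b + 2 * expected_residual n Lmax b) / \<mu>) m
     * ln (1 / \<epsilon>)"

end

theory Submission
  imports Defs
begin

text \<open>
  Write \<open>M\<close> for the threshold \<open>(\<L>(b) + 2 \<rho>(b)) / \<mu>\<close>. Up to the positive constant \<open>2 ln (1 / \<epsilon>)\<close>,
  the complexity is \<open>(n / m + 2 b) max M m\<close>. While \<open>m < M\<close> the number of iterations is stuck at \<open>M\<close>,
  so a longer loop only saves full gradients and the product falls strictly with \<open>m\<close>. Once \<open>m > M\<close>
  the product is \<open>n + 2 b m\<close>, which rises strictly. So \<open>M\<close> is the unique minimizer, provided that it
  is admissible, that is, positive (\<open>complexity_threshold_pos\<close>).
\<close>

lemma loop_cost_strict_min:
  fixes N B M m :: real
  assumes "0 < N" "0 < B" "0 < M" "0 < m" "m \<noteq> M"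
  shows "(N / M + B) * M < (N / m + B) * max M m"
proof (cases "m < M")
  case True
  with assms have "N / M < N / m"
    by (simp add: divide_strict_left_mono)
  with True assms show ?thesis
    by (simp add: mult_strict_right_mono)
next
  case False
  with assms have "M < m" by simp
  then have "B * M < B * m" using assms by simp
  with \<open>M < m\<close> assms show ?thesis
    by (simp add: distrib_right)
qed

lemma expected_residual_nonneg:
  assumes "b \<in> {1..n}" "0 \<le> Lmax"
  shows "0 \<le> expected_residual n Lmax b"
  using assms unfolding expected_residual_def by simp

text \<open>
  Both summands of \<open>expected_smoothness\<close> are nonnegative. The first vanishes only for \<open>b = n\<close> and the
  second only for \<open>b = 1\<close>, and these two cases cannot occur together when \<open>n \<ge> 2\<close>.
\<close>
lemma expected_smoothness_pos:
  assumes "n \<ge> 2" "b \<in> {1..n}" "0 < Lmax" "0 < L"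
  shows "0 < expected_smoothness n Lmax L b"
proof (cases "b = n")
  case True
  with assms show ?thesis
    by (simp add: expected_smoothness_def)
next
  case False
  with assms have "b < n" by simp
  then have "0 < 1 / real b * ((real n - real b) / (real n - 1)) * Lmax"
    using assms by simp
  moreover have "0 \<le> real n / real b * ((real b - 1) / (real n - 1)) * L"
    using assms by simp
  ultimately show ?thesis
    unfolding expected_smoothness_def by linarith
qed

lemma complexity_threshold_pos:
  assumes "n \<ge> 2" "b \<in> {1..n}" "0 < Lmax" "0 < L" "0 < \<mu>"
  shows "0 < (expected_smoothness n Lmax L b + 2 * expected_residual n Lmax b) / \<mu>"
  using expected_smoothness_pos[of n b Lmax L] expected_residual_nonneg[of b n Lmax] assms
  by simp

lemma is_arg_min_unique_iff:
  fixes g :: "'a \<Rightarrow> 'b::order"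
  assumes "P a" "\<And>y. P y \<Longrightarrow> y \<noteq> a \<Longrightarrow> g a < g y"
  shows "is_arg_min g P x \<longleftrightarrow> x = a"
  using assms unfolding is_arg_min_def by (metis less_asym)

theorem proposition6p1:
  fixes F :: "nat \<Rightarrow> real ^ 'd \<Rightarrow> real" and f :: "real ^ 'd \<Rightarrow> real"
    and Ls :: "nat \<Rightarrow> real" and L Lmax \<mu> \<epsilon> :: real and n b :: nat
  assumes "n \<ge> 2" and "b \<in> {1..n}" and "0 < \<epsilon>" and "\<epsilon> < 1"
    and "0 < L" and "0 < Lmax" and "0 < \<mu>"
    and "f = (\<lambda>x. 1 / real n * (\<Sum>i=1..n. F i x))"
    and "L_smooth L f" and "strongly_convex \<mu> f"
    and "\<And>i. i \<in> {1..n} \<Longrightarrow> convex_on UNIV (F i)"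
    and "\<And>i. i \<in> {1..n} \<Longrightarrow> L_smooth (Ls i) (F i)"
    and "Lmax = Max (Ls ` {1..n})"
  defines "mstar \<equiv> (expected_smoothness n Lmax L b + 2 * expected_residual n Lmax b) / \<mu>"
  shows "(\<forall>m. is_arg_min (total_complexity n Lmax L \<mu> \<epsilon> b) (\<lambda>m. 0 < m) m \<longleftrightarrow> m = mstar)
    \<and> total_complexity n Lmax L \<mu> \<epsilon> b mstar =
        2 * (real n + 2 * real b *
          ((expected_smoothness n Lmax L b + 2 * expected_residual n Lmax b) / \<mu>)) * ln (1 / \<epsilon>)"
proof -
  have pos: "0 < mstar"
    unfolding mstar_def using assms by (intro complexity_threshold_pos)
  have log_pos: "0 < ln (1 / \<epsilon>)"
    using assms by simp
  have cost: "total_complexity n Lmax L \<mu> \<epsilon> b m =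
      2 * ln (1 / \<epsilon>) * ((real n / m + 2 * real b) * max mstar m)" for m
    unfolding total_complexity_def mstar_def by (simp only: mult_ac)
  have strict: "total_complexity n Lmax L \<mu> \<epsilon> b mstar < total_complexity n Lmax L \<mu> \<epsilon> b m"
    if "0 < m" "m \<noteq> mstar" for m
  proof -
    have "(real n / mstar + 2 * real b) * mstar < (real n / m + 2 * real b) * max mstar m"
      using loop_cost_strict_min[of "real n" "2 * real b" mstar m] assms(1,2) pos that by simp
    then show ?thesis
      unfolding cost using log_pos by simp
  qed
  have "is_arg_min (total_complexity n Lmax L \<mu> \<epsilon> b) (\<lambda>m. 0 < m) m \<longleftrightarrow> m = mstar" for m
    using pos strict by (intro is_arg_min_unique_iff)
  moreover have "total_complexity n Lmax L \<mu> \<epsilon> b mstar =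
      2 * (real n + 2 * real b * mstar) * ln (1 / \<epsilon>)"
    unfolding cost using pos by (simp add: algebra_simps)
  ultimately show ?thesis
    unfolding mstar_def by blast
qed

end
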